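(* Let $F(\cdot;\theta)$, $\theta\in\Theta$, be an exponential family of the first type with functions $A$ and $B$ and density $f_\theta(x)=f(x;\theta)$; write $F_\theta(x)=F(x;\theta)$. The maximum likelihood estimators of the PDF and CDF based on a random sample $X_1,\dots,X_n$ and on the upper record values $R_1,\dots,R_m$ are asymptotically unbiased; in other words, for each $x$, (i) $\lim_{n\to\infty}E[\hat f_{MLE,(X_1,\dots,X_n)}(x)]=f_\theta(x)$; (ii) $\lim_{m\to\infty}E[\hat f_{MLE,(R_1,\dots,R_m)}(x)]=f_\theta(x)$; (iii) $\lim_{n\to\infty}E[\hat F_{MLE,(X_1,\dots,X_n)}(x)]=F_\theta(x)$; (iv) $\lim_{m\to\infty}E[\hat F_{MLE,(R_1,\dots,R_m)}(x)]=F_\theta(x)$.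
   Context: Exponential family of the first type: the family of distributions with cumulative distribution function $F(x;\theta)=1-\exp\{-B(\theta)A(x)\}$ for $x\in[a,b]$, where $A$ is an increasing differentiable function with $A(a)=0$, $A(b)=+\infty$ ($b=+\infty$ is allowed), and $B(\theta)>0$. The density is $f(x;\theta)=A'(x)B(\theta)\exp\{-A(x)B(\theta)\}$. The parameter set $\Theta\subseteq\mathbb{R}$ is an interval and $B:\Theta\to\mathbb{R}$ is twice differentiable and one-to-one. A random sample is an i.i.d. sample. Upper record values: $R_1=X_1$, and subsequent upper records are the successive observations of an i.i.d. sequence from $F(\cdot;\theta)$ that exceed all previous observations. The joint density of the first $m$ upper record values is taken to be $f(r_m;\theta)\prod_{i=1}^{m-1}h(r_i;\theta)=B^m(\theta)\left\{\prod_{i=1}^mA'(r_i)\right\}\exp\{-B(\theta)A(r_m)\}$ for $r_1<\dots<r_m$, where $h=f/(1-F)$; in particular $A(R_m)$ has the Gamma distribution with shape $m$ and scale $1/B(\theta)$. Estimators (for fixed $x$): $\hat f_{MLE,(X_1,\dots,X_n)}(x)=\frac{nA'(x)}{\sum_{i=1}^nA(X_i)}\exp\left(-\frac{nA(x)}{\sum_{i=1}^nA(X_i)}\right)$, $\hat F_{MLE,(X_1,\dots,X_n)}(x)=1-\exp\left(-\frac{nA(x)}{\sum_{i=1}^nA(X_i)}\right)$, $\hat f_{MLE,(R_1,\dots,R_m)}(x)=\frac{mA'(x)}{A(R_m)}\exp\left(-\frac{mA(x)}{A(R_m)}\right)$, $\hat F_{MLE,(R_1,\dots,R_m)}(x)=1-\exp\left(-\frac{mA(x)}{A(R_m)}\right)$.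 Expectations are under the true parameter $\theta$. *)

theory Defs
  imports "HOL-Probability.Probability"
begin

definition supp :: "real \<Rightarrow> ereal \<Rightarrow> real set" where
  "supp a b = {x. a \<le> x \<and> ereal x < b}"

text \<open>The right endpoint is \<open>b = \<infinity>\<close> or a real number; the condition \<open>A(b) = \<infinity>\<close> is a left limit at \<open>b\<close>,
  so that \<open>A\<close> is a real-valued function on \<open>[a, b)\<close>. At the point \<open>a\<close> its derivative \<open>A'\<close> is
  one-sided. The assumption \<open>A_measurable\<close> only concerns the (irrelevant) values of the total
  function \<open>A\<close> outside \<open>[a, b)\<close>: on \<open>[a, b)\<close> measurability follows from monotonicity, and
  observations lie outside \<open>[a, b)\<close> with probability zero only.\<close>

locale exp_family_first_type =
  fixes a :: real and b :: ereal and A A' :: "real \<Rightarrow> real"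
    and \<Theta> :: "real set" and B :: "real \<Rightarrow> real"
  assumes a_less_b: "ereal a < b"
    and A_mono: "mono_on (supp a b) A"
    and A_deriv: "\<And>x. x \<in> supp a b \<Longrightarrow> (A has_real_derivative A' x) (at x within supp a b)"
    and A_left: "A a = 0"
    and A_right: "filterlim (\<lambda>y. A (real_of_ereal y)) at_top (at_left b)"
    and A_measurable: "A \<in> borel_measurable borel"
    and Theta_interval: "is_interval \<Theta>"
    and B_pos: "\<And>t. t \<in> \<Theta> \<Longrightarrow> B t > 0"
    and B_inj: "inj_on B \<Theta>"
    and B_twice_differentiable:
      "\<exists>B'. (\<forall>t\<in>\<Theta>. (B has_real_derivative B' t) (at t within \<Theta>)) \<and> B' differentiable_on \<Theta>"

text \<open>Densities and distribution functions, and their estimators, are extended to the whole real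
  line by their values \<open>0\<close> and \<open>0\<close>/\<open>1\<close> outside \<open>[a, b)\<close>.\<close>

definition family_cdf ::
    "real \<Rightarrow> ereal \<Rightarrow> (real \<Rightarrow> real) \<Rightarrow> (real \<Rightarrow> real) \<Rightarrow> real \<Rightarrow> real \<Rightarrow> real" where
  "family_cdf a b A B \<theta> x =
     (if x < a then 0 else if ereal x < b then 1 - exp (- (B \<theta> * A x)) else 1)"

definition family_pdf ::
    "real \<Rightarrow> ereal \<Rightarrow> (real \<Rightarrow> real) \<Rightarrow> (real \<Rightarrow> real) \<Rightarrow> (real \<Rightarrow> real) \<Rightarrow> real \<Rightarrow> real \<Rightarrow> real" where
  "family_pdf a b A A' B \<theta> x =
     (if x \<in> supp a b then A' x * B \<theta> * exp (- (A x * B \<theta>)) else 0)"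

text \<open>In a sequence \<open>xs\<close> of observations (indexed from \<open>0\<close>), \<open>record_index xs k\<close> is the index of the
  \<open>(k+1)\<close>-st upper record, while record values are numbered from \<open>1\<close>, so that
  \<open>upper_record xs 1 = xs 0\<close>. If there is no further record (a null event for i.i.d. samples with continuous distribution)
  the index is the unspecified value of the empty \<open>LEAST\<close>; \<open>upper_record xs 0\<close> is meaningless.\<close>

primrec record_index :: "(nat \<Rightarrow> real) \<Rightarrow> nat \<Rightarrow> nat" where
  "record_index xs 0 = 0"
| "record_index xs (Suc k) = (LEAST j. record_index xs k < j \<and> (\<forall>i<j. xs i < xs j))"

definition upper_record :: "(nat \<Rightarrow> real) \<Rightarrow> nat \<Rightarrow> real" where
  "upper_record xs m = xs (record_index xs (m - 1))"

definition mle_pdf_sample ::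
    "real \<Rightarrow> ereal \<Rightarrow> (real \<Rightarrow> real) \<Rightarrow> (real \<Rightarrow> real) \<Rightarrow> nat \<Rightarrow> (nat \<Rightarrow> real) \<Rightarrow> real \<Rightarrow> real" where
  "mle_pdf_sample a b A A' n xs x =
     (if x \<in> supp a b
      then real n * A' x / (\<Sum>i<n. A (xs i)) * exp (- (real n * A x / (\<Sum>i<n. A (xs i))))
      else 0)"

definition mle_cdf_sample ::
    "real \<Rightarrow> ereal \<Rightarrow> (real \<Rightarrow> real) \<Rightarrow> nat \<Rightarrow> (nat \<Rightarrow> real) \<Rightarrow> real \<Rightarrow> real" where
  "mle_cdf_sample a b A n xs x =
     (if x < a then 0
      else if ereal x < b then 1 - exp (- (real n * A x / (\<Sum>i<n. A (xs i))))
      else 1)"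

definition mle_pdf_record ::
    "real \<Rightarrow> ereal \<Rightarrow> (real \<Rightarrow> real) \<Rightarrow> (real \<Rightarrow> real) \<Rightarrow> nat \<Rightarrow> (nat \<Rightarrow> real) \<Rightarrow> real \<Rightarrow> real" where
  "mle_pdf_record a b A A' m xs x =
     (if x \<in> supp a b
      then real m * A' x / A (upper_record xs m) * exp (- (real m * A x / A (upper_record xs m)))
      else 0)"

definition mle_cdf_record ::
    "real \<Rightarrow> ereal \<Rightarrow> (real \<Rightarrow> real) \<Rightarrow> nat \<Rightarrow> (nat \<Rightarrow> real) \<Rightarrow> real \<Rightarrow> real" where
  "mle_cdf_record a b A m xs x =
     (if x < a then 0
      else if ereal x < b then 1 - exp (- (real m * A x / A (upper_record xs m)))
      else 1)"

end

theory Submission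
  imports Defs "HOL-Real_Asymp.Real_Asymp"
begin

text \<open>The variables \<open>Y\<^sub>i = A(X\<^sub>i)\<close> are independent and exponentially distributed with rate \<open>l = B(\<theta>)\<close>,
  so \<open>T\<^sub>n = Y\<^sub>1 + \<dots> + Y\<^sub>n\<close> has an Erlang distribution. By memorylessness, each record increment
  of the \<open>Y\<^sub>i\<close> is a fresh exponential variable, so that \<open>A(R\<^sub>n)\<close> has the same law as \<open>T\<^sub>n\<close>.
  All four estimators are therefore of the form \<open>g(n/T\<^sub>n)\<close> in law, with \<open>g\<close> Lipschitz on \<open>[0, \<infinity>)\<close> and
  \<open>g(l)\<close> the quantity to be estimated. The exact first two negative moments of the Erlang
  distribution give \<open>E[(n/T\<^sub>n - l)\<^sup>2] \<longlonglongrightarrow> 0\<close>, hence \<open>E[g(n/T\<^sub>n)] \<longlonglongrightarrow> g(l)\<close>. The law of large numbers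
  with bounded convergence would not suffice: for the density, \<open>g\<close> is unbounded where \<open>A(x) = 0\<close>.\<close>

section \<open>Upper records of exponential sequences\<close>

text \<open>Ensures that a further record always exists, so that the \<open>LEAST\<close> in
  \<open>record_index\<close> is attained. Natural thresholds make it a countable conjunction,
  suited to almost-sure statements.\<close>

definition unbounded_seq :: "(nat \<Rightarrow> real) \<Rightarrow> bool" where
  "unbounded_seq xs \<longleftrightarrow> (\<forall>c::nat. \<exists>j. real c < xs j)"

lemma unbounded_seq_case_nat:
  assumes "unbounded_seq xs"
  shows "unbounded_seq (case_nat y xs)"
  using assms unfolding unbounded_seq_def by (metis nat.case(2))

text \<open>The first value above the maximum of the initial block is a record.\<close>

lemma unbounded_seq_exceeds_initial:
  assumes "unbounded_seq xs"
  shows "\<exists>j>n. \<forall>i<j. xs i < xs j"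
proof -
  define c where "c = Max (xs ` {..n})"
  have le_c: "xs i \<le> c" if "i \<le> n" for i
    unfolding c_def using that by (intro Max_ge) auto
  obtain k :: nat where "c \<le> real k"
    using real_arch_simple by blast
  with assms obtain j0 where "c < xs j0"
    unfolding unbounded_seq_def by (meson le_less_trans)
  define j where "j = (LEAST j. c < xs j)"
  have j: "c < xs j"
    unfolding j_def using \<open>c < xs j0\<close> by (rule LeastI)
  moreover have "xs i \<le> c" if "i < j" for i
    using not_less_Least[of i "\<lambda>j. c < xs j"] that unfolding j_def by auto
  moreover have "n < j"
    using le_c[of j] j by (meson leI not_less)
  ultimately show ?thesis
    by (meson le_less_trans)
qed

text \<open>Records depend only on the order of the observations; this later carries them from the
  \<open>X i\<close> to the values \<open>A (X i)\<close>.\<close>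

lemma record_index_cong:
  assumes "\<And>i j. xs i < xs j \<longleftrightarrow> ys i < ys j"
  shows "record_index xs k = record_index ys k"
  by (induction k) (simp_all add: assms)

lemma record_index_Suc_greater:
  assumes "unbounded_seq xs"
  shows "record_index xs k < record_index xs (Suc k)"
  using LeastI_ex[OF unbounded_seq_exceeds_initial[OF assms, of "record_index xs k"]] by simp

text \<open>Here \<open>y\<close> is itself a record, and whatever beats \<open>y\<close> also beats
  \<open>w\<close>, so \<open>w\<close> can be forgotten.\<close>

lemma record_index_drop_first:
  assumes "unbounded_seq ys" "w < y"
  shows "record_index (case_nat w (case_nat y ys)) (Suc k) = Suc (record_index (case_nat y ys) k)"
proof (induction k)
  case 0
  have "(LEAST j. 0 < j \<and> (\<forall>i<j. case_nat w (case_nat y ys) i < case_nat w (case_nat y ys) j)) = 1"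
    by (rule Least_equality) (use assms in auto)
  then show ?case by simp
next
  case (Suc k)
  let ?u = "case_nat w (case_nat y ys)" and ?v = "case_nat y ys"
  define r where "r = record_index ?v k"
  have shift: "(Suc r < Suc m \<and> (\<forall>i<Suc m. ?u i < ?u (Suc m))) \<longleftrightarrow> (r < m \<and> (\<forall>i<m. ?v i < ?v m))" for m
  proof -
    have "w < ?v m" if "r < m" "\<forall>i<m. ?v i < ?v m"
    proof -
      have "?v 0 < ?v m"
        using that by (metis gr_zeroI not_less0)
      then show ?thesis
        using assms(2) by simp
    qed
    then show ?thesis
      by (auto simp: All_less_Suc2)
  qed
  have "(LEAST j. Suc r < j \<and> (\<forall>i<j. ?u i < ?u j)) = Suc (LEAST m. r < m \<and> (\<forall>i<m. ?v i < ?v m))"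
  proof -
    obtain j where "r < j \<and> (\<forall>i<j. ?v i < ?v j)"
      using unbounded_seq_exceeds_initial[OF unbounded_seq_case_nat[OF assms(1)], of r y] by blast
    then show ?thesis
      using shift
      by (intro Least_Suc2[of _ "Suc j" _ j]) auto
  qed
  then show ?case
    using Suc.IH unfolding r_def by simp
qed

text \<open>Here \<open>y\<close> is no record, and whatever beats \<open>w\<close> also beats
  \<open>y\<close>. The shift starts at \<open>Suc k\<close> because the initial record sits at
  position 0 in both sequences.\<close>

lemma record_index_skip_second:
  assumes "unbounded_seq ys" "y \<le> w"
  shows "record_index (case_nat w (case_nat y ys)) (Suc k) = Suc (record_index (case_nat w ys) (Suc k))"
proof (induction k)
  let ?u = "case_nat w (case_nat y ys)" and ?v = "case_nat w ys"
  \<comment> \<open>The case \<open>m = 0\<close> is position 1 on the left, where \<open>y\<close>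
    fails to beat \<open>w\<close>; hence the conjunct \<open>0 < m\<close>.\<close>
  have shift: "(r < Suc m \<and> (\<forall>i<Suc m. ?u i < ?u (Suc m))) \<longleftrightarrow> (r \<le> m \<and> 0 < m \<and> (\<forall>i<m. ?v i < ?v m))"
    for m r
    using assms(2) by (cases m) (auto simp: All_less_Suc2)
  have exceeds: "\<exists>j>r. \<forall>i<j. ?v i < ?v j" for r
    by (rule unbounded_seq_exceeds_initial[OF unbounded_seq_case_nat[OF assms(1)]])
  {
    case 0
    obtain j where "0 < j \<and> (\<forall>i<j. ?v i < ?v j)"
      using exceeds by blast
    then have "(LEAST j. 0 < j \<and> (\<forall>i<j. ?u i < ?u j)) = Suc (LEAST m. 0 < m \<and> (\<forall>i<m. ?v i < ?v m))"
      using shift[of 0]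
      by (intro Least_Suc2[of _ "Suc j" _ j]) auto
    then show ?case by simp
  next
    case (Suc k)
    define r where "r = record_index ?v (Suc k)"
    have eq: "\<forall>m. (Suc r < Suc m \<and> (\<forall>i<Suc m. ?u i < ?u (Suc m))) \<longleftrightarrow> (r < m \<and> (\<forall>i<m. ?v i < ?v m))"
      unfolding shift by auto
    obtain j where j: "r < j \<and> (\<forall>i<j. ?v i < ?v j)"
      using exceeds by blast
    have "(LEAST j. Suc r < j \<and> (\<forall>i<j. ?u i < ?u j)) = Suc (LEAST m. r < m \<and> (\<forall>i<m. ?v i < ?v m))"
      by (rule Least_Suc2[OF eq[THEN spec, THEN iffD2, OF j] j _ eq]) simp
    then show ?case
      using Suc.IH unfolding r_def by simp
  }
qed

lemma upper_record_drop_first: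
  assumes "unbounded_seq ys" "w < y"
  shows "upper_record (case_nat w (case_nat y ys)) (Suc (Suc k)) = upper_record (case_nat y ys) (Suc k)"
  using record_index_drop_first[OF assms, of k] by (simp add: upper_record_def del: record_index.simps)

lemma upper_record_skip_second:
  assumes "unbounded_seq ys" "y \<le> w"
  shows "upper_record (case_nat w (case_nat y ys)) (Suc (Suc k)) = upper_record (case_nat w ys) (Suc (Suc k))"
proof -
  \<comment> \<open>Position \<open>Suc p\<close> on the left and \<open>p\<close> on the right are
    sure to hold the same value only for \<open>p > 0\<close>; at \<open>p = 0\<close> they hold
    \<open>y\<close> and \<open>w\<close>.\<close>
  have "0 < record_index (case_nat w ys) (Suc k)"
    using record_index_Suc_greater[OF unbounded_seq_case_nat[OF assms(1)]] by (metis gr_zeroI not_less0)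
  then show ?thesis
    using record_index_skip_second[OF assms, of k]
    by (simp add: upper_record_def gr0_conv_Suc del: record_index.simps) (metis nat.case(2))
qed

lemma measurable_record_index [measurable]:
  "(\<lambda>xs. record_index xs k) \<in> measurable (\<Pi>\<^sub>M i\<in>UNIV. borel) (count_space UNIV)"
  by (induction k) (simp_all, measurable)

lemma measurable_upper_record [measurable]:
  "(\<lambda>xs. upper_record xs m) \<in> borel_measurable (\<Pi>\<^sub>M i\<in>UNIV. borel)"
  unfolding upper_record_def
  by (rule measurable_compose_countable[where f="\<lambda>i xs. xs i"]) measurable

text \<open>Conditioning on the first observation: an independent draw from \<open>M\<close> put in
  front of a sequence with law \<open>S\<close> gives law \<open>S\<close> again.\<close>

lemma (in sequence_space) nn_integral_PiM_iter:
  assumes [measurable]: "f \<in> borel_measurable S"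
  shows "(\<integral>\<^sup>+xs. f xs \<partial>S) = (\<integral>\<^sup>+y. \<integral>\<^sup>+ys. f (case_nat y ys) \<partial>S \<partial>M)"
proof -
  have "(\<integral>\<^sup>+xs. f xs \<partial>S) = (\<integral>\<^sup>+z. f (case z of (y, ys) \<Rightarrow> case_nat y ys) \<partial>(M \<Otimes>\<^sub>M S))"
    by (subst PiM_iter[symmetric]) (subst nn_integral_distr, measurable)
  also have "\<dots> = (\<integral>\<^sup>+y. \<integral>\<^sup>+ys. f (case_nat y ys) \<partial>S \<partial>M)"
    by (subst P.nn_integral_fst[symmetric]) simp_all
  finally show ?thesis .
qed

section \<open>Sequences of independent exponential variables\<close>

abbreviation exponential_measure :: "real \<Rightarrow> real measure" where
  "exponential_measure l \<equiv> density lborel (\<lambda>x. ennreal (exponential_density l x))"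

abbreviation exponential_sequence :: "real \<Rightarrow> (nat \<Rightarrow> real) measure" where
  "exponential_sequence l \<equiv> \<Pi>\<^sub>M i\<in>UNIV. exponential_measure l"

lemma sequence_space_exponential:
  assumes "0 < l"
  shows "sequence_space (exponential_measure l)"
proof -
  interpret prob_space "exponential_measure l"
    using assms by (rule prob_space_exponential_density)
  show ?thesis
    by unfold_locales
qed

lemma emeasure_exponential_atMost:
  assumes "0 < l" "0 \<le> c"
  shows "emeasure (exponential_measure l) {..c} = ennreal (1 - exp (- l * c))"
  using emeasure_erlang_density[OF assms(1), of 0 c] assms(2) by (simp add: erlang_CDF_0)

lemma AE_exponential_nonneg: "AE y in exponential_measure l. 0 \<le> y"
  by (subst AE_density) (auto simp: exponential_density_def intro!: AE_I2)

text \<open>Each observation stays below \<open>c\<close> with the same probability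
  \<open>?q < 1\<close>, so all of them do with probability \<open>lim ?q ^ n = 0\<close>; there are
  only countably many \<open>c\<close>.\<close>

lemma AE_exponential_sequence_unbounded:
  assumes "0 < l"
  shows "AE xs in exponential_sequence l. unbounded_seq xs"
proof -
  interpret sequence_space "exponential_measure l"
    by (rule sequence_space_exponential[OF assms])
  have "AE xs in S. \<exists>j. real c < xs j" for c :: nat
  proof -
    let ?q = "1 - exp (- l * real c)"
    have q: "0 \<le> ?q" "?q < 1"
      using assms by auto
    have "measure (exponential_measure l) {..real c} = ?q"
      using emeasure_exponential_atMost[OF assms, of "real c"] q(1) by (simp add: measure_def)
    then have "(\<lambda>n. ?q ^ Suc n) \<longlonglongrightarrow> measure S (Pi UNIV (\<lambda>_. {..real c}))"
      using measure_PiM_countable[of "\<lambda>_. {..real c}"] by simp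
    moreover have "(\<lambda>n. ?q ^ Suc n) \<longlonglongrightarrow> 0"
      using q by (intro LIMSEQ_Suc LIMSEQ_power_zero) auto
    ultimately have "measure S (Pi UNIV (\<lambda>_. {..real c})) = 0"
      using LIMSEQ_unique by blast
    then have "AE xs in S. xs \<notin> Pi UNIV (\<lambda>_. {..real c})"
      by (subst AE_iff_measurable[where N="Pi UNIV (\<lambda>_. {..real c})"])
        (auto simp: P.emeasure_eq_measure space_PiM)
    then show ?thesis
      by eventually_elim (auto simp: Pi_iff not_le)
  qed
  then show ?thesis
    unfolding unbounded_seq_def by (simp add: AE_all_countable)
qed

text \<open>Translation by \<open>w\<close> multiplies the density by the constant
  \<open>exp (- l * w)\<close>.\<close>

lemma nn_integral_exponential_memoryless:
  assumes "0 \<le> w" and [measurable]: "f \<in> borel_measurable borel"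
  shows "(\<integral>\<^sup>+y. f y * indicator {w<..} y \<partial>exponential_measure l)
    = ennreal (exp (- l * w)) * (\<integral>\<^sup>+y. f (w + y) \<partial>exponential_measure l)"
proof -
  \<comment> \<open>At \<open>y = 0\<close> the strict indicator vanishes while the density need
    not, so this null point is left out; for \<open>y < 0\<close> both sides are 0.\<close>
  have density: "ennreal (exponential_density l (w + y)) * (f (w + y) * indicator {w<..} (w + y))
      = ennreal (exp (- l * w)) * (ennreal (exponential_density l y) * f (w + y))" if "y \<noteq> 0" for y
  proof (cases "0 < y")
    case True
    then have "exponential_density l (w + y) = exp (- l * w) * exponential_density l y"
      using assms(1) by (simp add: exponential_density_def exp_add[symmetric] algebra_simps)
    then show ?thesis
      using True by (simp add: ennreal_mult' mult.assoc)
  qed (use that in \<open>simp add: exponential_density_def\<close>)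
  have "(\<integral>\<^sup>+y. f y * indicator {w<..} y \<partial>exponential_measure l)
      = (\<integral>\<^sup>+y. ennreal (exponential_density l (w + y)) * (f (w + y) * indicator {w<..} (w + y)) \<partial>lborel)"
    by (subst nn_integral_density, simp, simp, subst nn_integral_real_affine[where c=1 and t=w]) auto
  also have "\<dots> = (\<integral>\<^sup>+y. ennreal (exp (- l * w)) * (ennreal (exponential_density l y) * f (w + y)) \<partial>lborel)"
    by (intro nn_integral_cong_AE) (use AE_lborel_singleton[of 0] density in auto)
  also have "\<dots> = ennreal (exp (- l * w)) * (\<integral>\<^sup>+y. f (w + y) \<partial>exponential_measure l)"
    by (subst nn_integral_cmult, simp, subst nn_integral_density) auto
  finally show ?thesis .
qed

lemma sets_exponential_sequence [measurable_cong]: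
  "sets (exponential_sequence l) = sets (\<Pi>\<^sub>M i\<in>UNIV. borel)"
  by (rule sets_PiM_cong) simp_all

text \<open>\<open>case_nat w ys\<close> prepends a starting record \<open>w\<close> to the observations \<open>ys\<close>. Conditioning on the first
  observation \<open>y\<close> of \<open>ys\<close>, either \<open>y > w\<close> is the next record or \<open>y\<close> can be dropped, so with \<open>p = P(y > w)\<close>
  the left side \<open>H\<close> satisfies \<open>H = p J + (1 - p) H\<close>, where \<open>J\<close> is the right side by induction and
  memorylessness; boundedness of \<open>f\<close> makes \<open>H\<close> finite, so that it can be cancelled.\<close>

lemma nn_integral_upper_record_above:
  fixes f :: "real \<Rightarrow> ennreal"
  assumes "0 < l" and [measurable]: "f \<in> borel_measurable borel" and "\<And>y. f y \<le> 1" and "0 \<le> w"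
  shows "(\<integral>\<^sup>+ys. f (upper_record (case_nat w ys) (Suc k)) \<partial>exponential_sequence l)
    = (\<integral>\<^sup>+ys. f (w + (\<Sum>i<k. ys i)) \<partial>exponential_sequence l)"
  using \<open>0 \<le> w\<close>
proof (induction k arbitrary: w)
  case 0
  then show ?case by (simp add: upper_record_def)
next
  case (Suc k)
  interpret sequence_space "exponential_measure l"
    by (rule sequence_space_exponential[OF assms(1)])
  let ?H = "\<lambda>k w. \<integral>\<^sup>+ys. f (upper_record (case_nat w ys) (Suc k)) \<partial>S"
  let ?J = "\<lambda>k w. \<integral>\<^sup>+ys. f (w + (\<Sum>i<k. ys i)) \<partial>S"
  let ?p = "exp (- l * w)"
  have J_iter: "?J (Suc k) w = (\<integral>\<^sup>+y. ?J k (w + y) \<partial>exponential_measure l)"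
    by (subst nn_integral_PiM_iter) (simp_all add: sum.lessThan_Suc_shift add.assoc del: sum.lessThan_Suc)
  have inner: "(\<integral>\<^sup>+ys. f (upper_record (case_nat w (case_nat y ys)) (Suc (Suc k))) \<partial>S)
      = ?J k y * indicator {w<..} y + ?H (Suc k) w * indicator {..w} y" for y
  proof (cases "w < y")
    case True
    have "(\<integral>\<^sup>+ys. f (upper_record (case_nat w (case_nat y ys)) (Suc (Suc k))) \<partial>S) = ?H k y"
      using AE_exponential_sequence_unbounded[OF assms(1)]
      by (intro nn_integral_cong_AE) (auto simp: upper_record_drop_first[OF _ True])
    \<comment> \<open>The induction hypothesis is applied with the new record \<open>y\<close> as
      the start, which is why \<open>w\<close> is generalised.\<close>
    also have "\<dots> = ?J k y"
      using True \<open>0 \<le> w\<close> by (intro Suc.IH) simp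
    finally show ?thesis
      using True by simp
  next
    case False
    then have "y \<le> w" by simp
    have "(\<integral>\<^sup>+ys. f (upper_record (case_nat w (case_nat y ys)) (Suc (Suc k))) \<partial>S) = ?H (Suc k) w"
      using AE_exponential_sequence_unbounded[OF assms(1)]
      by (intro nn_integral_cong_AE) (auto simp: upper_record_skip_second[OF _ \<open>y \<le> w\<close>])
    then show ?thesis
      using \<open>y \<le> w\<close> by simp
  qed
  have "?H (Suc k) w = (\<integral>\<^sup>+y. \<integral>\<^sup>+ys. f (upper_record (case_nat w (case_nat y ys)) (Suc (Suc k))) \<partial>S
      \<partial>exponential_measure l)"
    by (subst nn_integral_PiM_iter) simp_all
  also have "\<dots> = (\<integral>\<^sup>+y. ?J k y * indicator {w<..} y \<partial>exponential_measure l)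
      + ?H (Suc k) w * emeasure (exponential_measure l) {..w}"
    unfolding inner by (subst nn_integral_add) (simp_all add: nn_integral_cmult_indicator)
  also have "(\<integral>\<^sup>+y. ?J k y * indicator {w<..} y \<partial>exponential_measure l)
      = ennreal ?p * (\<integral>\<^sup>+y. ?J k (w + y) \<partial>exponential_measure l)"
    using Suc.prems by (rule nn_integral_exponential_memoryless) simp
  also have "emeasure (exponential_measure l) {..w} = ennreal (1 - ?p)"
    using assms(1) Suc.prems by (rule emeasure_exponential_atMost)
  finally have eq: "?H (Suc k) w = ennreal ?p * ?J (Suc k) w + ?H (Suc k) w * ennreal (1 - ?p)"
    unfolding J_iter .
  have bound: "(\<integral>\<^sup>+ys. f (g ys) \<partial>S) \<le> 1" for g
    using nn_integral_mono[of S "\<lambda>ys. f (g ys)" "\<lambda>_. 1"] assms(3) by (simp add: P.emeasure_space_1)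
  obtain h where h: "?H (Suc k) w = ennreal h" "0 \<le> h"
    using bound[of "\<lambda>ys. upper_record (case_nat w ys) (Suc (Suc k))"]
    by (cases "?H (Suc k) w") (auto simp: top_unique)
  obtain j where j: "?J (Suc k) w = ennreal j" "0 \<le> j"
    using bound[of "\<lambda>ys. w + (\<Sum>i<Suc k. ys i)"]
    by (cases "?J (Suc k) w") (auto simp: top_unique)
  have p: "0 < ?p" "?p \<le> 1"
    using assms(1) Suc.prems by auto
  have "ennreal h = ennreal (?p * j + h * (1 - ?p))"
    using eq h j p by (simp add: ennreal_mult ennreal_plus)
  then have "h = ?p * j + h * (1 - ?p)"
    using h j p by (subst (asm) ennreal_inj) (auto intro!: add_nonneg_nonneg mult_nonneg_nonneg)
  then have "?p * h = ?p * j"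
    by (simp add: algebra_simps)
  then show ?case
    using h j by simp
qed

text \<open>The first observation is the first record and almost surely nonnegative, so it can serve
  as the start \<open>w\<close>; the test functions are indicators, hence bounded by 1.\<close>

lemma distr_upper_record_exponential:
  assumes "0 < l"
  shows "distr (exponential_sequence l) borel (\<lambda>xs. upper_record xs (Suc k))
    = distr (exponential_sequence l) borel (\<lambda>xs. \<Sum>i<Suc k. xs i)"
proof (rule measure_eqI)
  interpret sequence_space "exponential_measure l"
    by (rule sequence_space_exponential[OF assms])
  fix B assume "B \<in> sets (distr S borel (\<lambda>xs. upper_record xs (Suc k)))"
  then have [measurable]: "B \<in> sets borel"
    by simp
  have distr: "emeasure (distr S borel g) B = (\<integral>\<^sup>+xs. indicator B (g xs) \<partial>S)"
    if "g \<in> borel_measurable S" for g :: "(nat \<Rightarrow> real) \<Rightarrow> real"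
    using that by (subst nn_integral_indicator[symmetric], simp, subst nn_integral_distr) auto
  have "emeasure (distr S borel (\<lambda>xs. upper_record xs (Suc k))) B
      = (\<integral>\<^sup>+y. \<integral>\<^sup>+ys. indicator B (upper_record (case_nat y ys) (Suc k)) \<partial>S \<partial>exponential_measure l)"
    by (subst distr, simp, subst nn_integral_PiM_iter) simp_all
  also have "\<dots> = (\<integral>\<^sup>+y. \<integral>\<^sup>+ys. indicator B (y + (\<Sum>i<k. ys i)) \<partial>S \<partial>exponential_measure l)"
    using AE_exponential_nonneg[of l]
    by (intro nn_integral_cong_AE, eventually_elim)
      (rule nn_integral_upper_record_above[OF assms], auto split: split_indicator)
  also have "\<dots> = emeasure (distr S borel (\<lambda>xs. \<Sum>i<Suc k. xs i)) B"
    by (subst distr, simp, subst nn_integral_PiM_iter)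
      (simp_all add: sum.lessThan_Suc_shift del: sum.lessThan_Suc)
  finally show "emeasure (distr S borel (\<lambda>xs. upper_record xs (Suc k))) B
      = emeasure (distr S borel (\<lambda>xs. \<Sum>i<Suc k. xs i)) B" .
qed simp

section \<open>Negative moments of the Erlang distribution\<close>

text \<open>Up to the constant, the factor \<open>(1 / x) ^ i\<close> lowers the Erlang shape from
  \<open>k + 1\<close> to \<open>k + 1 - i\<close>, and the new density has mass 1. The bound
  \<open>i \<le> k\<close> keeps the shape positive.\<close>

lemma has_bochner_integral_erlang_inverse_power:
  assumes "0 < l" "i \<le> k"
  shows "has_bochner_integral lborel (\<lambda>x. erlang_density k l x * (1 / x) ^ i) (l ^ i * fact (k - i) / fact k)"
proof -
  have "has_bochner_integral lborel (erlang_density (k - i) l) 1"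
    using nn_integral_erlang_ith_moment[OF assms(1), of "k - i" 0] assms(1)
    by (intro has_bochner_integral_nn_integral) auto
  then have "has_bochner_integral lborel
      (\<lambda>x. (l ^ i * fact (k - i) / fact k) * erlang_density (k - i) l x) (l ^ i * fact (k - i) / fact k * 1)"
    by (rule has_bochner_integral_mult_right)
  \<comment> \<open>At \<open>x = 0\<close> the quotient \<open>1 / x\<close> is 0 and the identity
    can fail, but this is a null set.\<close>
  moreover have "(l ^ i * fact (k - i) / fact k) * erlang_density (k - i) l x
      = erlang_density k l x * (1 / x) ^ i" if "x \<noteq> 0" for x
  proof -
    have "l ^ Suc k = l ^ i * l ^ Suc (k - i)" "x ^ k = x ^ i * x ^ (k - i)"
      using assms(2) by (simp_all flip: power_add)
    then show ?thesis
      using that by (simp add: erlang_density_def power_one_over field_simps del: power_Suc)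
  qed
  then have "AE x in lborel. (l ^ i * fact (k - i) / fact k) * erlang_density (k - i) l x
      = erlang_density k l x * (1 / x) ^ i"
    using AE_lborel_singleton[of "0::real"] by (auto elim: eventually_mono)
  ultimately show ?thesis
    by (subst (asm) has_bochner_integral_cong_AE[where g="\<lambda>x. erlang_density k l x * (1 / x) ^ i"]) simp_all
qed

lemma (in prob_space) has_bochner_integral_erlang_distributed_inverse_power:
  assumes "0 < l" "i \<le> k" and T: "distributed M lborel T (erlang_density k l)"
  shows "has_bochner_integral M (\<lambda>\<omega>. (1 / T \<omega>) ^ i) (l ^ i * fact (k - i) / fact k)"
  using has_bochner_integral_erlang_inverse_power[OF assms(1,2)]
    distributed_integrable[OF T, of "\<lambda>x. (1 / x) ^ i"] distributed_integral[OF T, of "\<lambda>x. (1 / x) ^ i"] assms(1)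
  by (simp add: has_bochner_integral_iff)

text \<open>The square is expanded and the inverse moments of order 1 and 2 are inserted; order 2
  needs \<open>2 \<le> n - 1\<close>, hence \<open>3 \<le> n\<close>.\<close>

lemma (in prob_space) has_bochner_integral_erlang_inverse_deviation:
  assumes "0 < l" "3 \<le> n" and T: "distributed M lborel T (erlang_density (n - 1) l)"
  shows "has_bochner_integral M (\<lambda>\<omega>. (real n / T \<omega> - l)\<^sup>2)
    (l\<^sup>2 * (real n ^ 2 / ((real n - 1) * (real n - 2)) - 2 * real n / (real n - 1) + 1))"
proof -
  obtain k where n: "n = k + 3"
    using assms(2) by (metis add.commute le_Suc_ex)
  have fact: "fact (k + 2) = (real k + 2) * ((real k + 1) * fact k)" "fact (k + 1) = (real k + 1) * fact k"
    by (simp_all add: numeral_2_eq_2 algebra_simps)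
  have "has_bochner_integral M (\<lambda>\<omega>. real n ^ 2 * (1 / T \<omega>) ^ 2 - 2 * real n * l * (1 / T \<omega>) ^ 1 + l\<^sup>2)
      (real n ^ 2 * (l ^ 2 * fact (n - 1 - 2) / fact (n - 1))
        - 2 * real n * l * (l ^ 1 * fact (n - 1 - 1) / fact (n - 1)) + l\<^sup>2)"
    using assms
    by (intro has_bochner_integral_add has_bochner_integral_diff has_bochner_integral_mult_right
        has_bochner_integral_erlang_distributed_inverse_power)
      (auto simp: has_bochner_integral_iff prob_space)
  also have "(\<lambda>\<omega>. real n ^ 2 * (1 / T \<omega>) ^ 2 - 2 * real n * l * (1 / T \<omega>) ^ 1 + l\<^sup>2)
      = (\<lambda>\<omega>. (real n / T \<omega> - l)\<^sup>2)"
    by (simp add: fun_eq_iff power2_eq_square algebra_simps)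
  also have "real n ^ 2 * (l ^ 2 * fact (n - 1 - 2) / fact (n - 1))
        - 2 * real n * l * (l ^ 1 * fact (n - 1 - 1) / fact (n - 1)) + l\<^sup>2
      = l\<^sup>2 * (real n ^ 2 / ((real n - 1) * (real n - 2)) - 2 * real n / (real n - 1) + 1)"
  proof -
    have "n - 1 = k + 2" "n - 1 - 2 = k" "n - 1 - 1 = k + 1" "real n - 1 = real k + 2" "real n - 2 = real k + 1"
      by (simp_all add: n)
    moreover have "fact k / fact (k + 2) = 1 / ((real k + 2) * (real k + 1))"
      "fact (k + 1) / fact (k + 2) = 1 / (real k + 2)"
      unfolding fact by simp_all
    ultimately show ?thesis
      by (simp only: times_divide_eq_right[symmetric]) (simp add: power2_eq_square add_divide_distrib algebra_simps)
  qed
  finally show ?thesis .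
qed

lemma (in prob_space) AE_erlang_distributed_nonneg:
  assumes "distributed M lborel T (erlang_density k l)"
  shows "AE \<omega> in M. 0 \<le> T \<omega>"
proof (rule AE_distrD[where f=T and M'=lborel])
  show "T \<in> measurable M lborel"
    using assms by (rule distributed_measurable)
  show "AE x in distr M lborel T. 0 \<le> x"
    unfolding distributed_distr_eq_density[OF assms]
    by (subst AE_density) (auto simp: erlang_density_def intro!: AE_I2)
qed

text \<open>With \<open>Z = |n/T - l|\<close>, the error is at most \<open>C * E Z\<close>, hence at
  most \<open>C * sqrt (E Z^2)\<close>, and the exact second moment tends to 0.\<close>

lemma (in prob_space) expectation_lipschitz_erlang_inverse_tendsto:
  fixes g :: "real \<Rightarrow> real"
  assumes "0 < l" and T: "\<And>n. 1 \<le> n \<Longrightarrow> distributed M lborel (T n) (erlang_density (n - 1) l)"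
    and [measurable]: "g \<in> borel_measurable borel"
    and lipschitz: "\<And>t. 0 \<le> t \<Longrightarrow> \<bar>g t - g l\<bar> \<le> C * \<bar>t - l\<bar>"
  shows "(\<lambda>n. \<integral>\<omega>. g (real n / T n \<omega>) \<partial>M) \<longlonglongrightarrow> g l"
proof -
  let ?Z = "\<lambda>n \<omega>. \<bar>real n / T n \<omega> - l\<bar>"
  let ?v = "\<lambda>n. l\<^sup>2 * (real n ^ 2 / ((real n - 1) * (real n - 2)) - 2 * real n / (real n - 1) + 1)"
  have "?v \<longlonglongrightarrow> 0"
    by real_asymp
  then have sqrt_v: "(\<lambda>n. C * sqrt (?v n)) \<longlonglongrightarrow> 0"
    using tendsto_mult_left[OF tendsto_real_sqrt, of ?v 0 sequentially C] by simp
  have bound: "\<bar>(\<integral>\<omega>. g (real n / T n \<omega>) \<partial>M) - g l\<bar> \<le> C * sqrt (?v n)" if "3 \<le> n" for n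
  proof -
    have Tn: "distributed M lborel (T n) (erlang_density (n - 1) l)"
      using that by (intro T) simp
    have [measurable]: "T n \<in> borel_measurable M"
      using distributed_measurable[OF Tn] by simp
    have sq: "has_bochner_integral M (\<lambda>\<omega>. (?Z n \<omega>)\<^sup>2) (?v n)"
      using has_bochner_integral_erlang_inverse_deviation[OF assms(1) that Tn] by simp
    have sq_integrable: "integrable M (\<lambda>\<omega>. (?Z n \<omega>)\<^sup>2)"
      using sq by (rule integrable.intros)
    have Z: "integrable M (?Z n)"
      by (rule square_integrable_imp_integrable[OF _ sq_integrable]) measurable
    \<comment> \<open>Nonnegativity of the variance serves as the Cauchy-Schwarz inequality.\<close>
    have "(expectation (?Z n))\<^sup>2 \<le> expectation (\<lambda>\<omega>. (?Z n \<omega>)\<^sup>2)"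
      using variance_positive[of "?Z n"] unfolding variance_eq[OF Z sq_integrable] by linarith
    also have "\<dots> = ?v n"
      using sq by (rule has_bochner_integral_integral_eq)
    finally have EZ: "expectation (?Z n) \<le> sqrt (?v n)"
      by (rule real_le_rsqrt)
    \<comment> \<open>The point \<open>l + 1\<close> has distance 1 from \<open>l\<close>, so
      \<open>C\<close> bounds an absolute value.\<close>
    have C: "0 \<le> C"
      using lipschitz[of "l + 1"] assms(1) by simp
    have dev: "AE \<omega> in M. \<bar>g (real n / T n \<omega>) - g l\<bar> \<le> C * ?Z n \<omega>"
      using AE_erlang_distributed_nonneg[OF Tn] by eventually_elim (auto intro!: lipschitz)
    have int: "integrable M (\<lambda>\<omega>. g (real n / T n \<omega>) - g l)"
      by (rule Bochner_Integration.integrable_bound[where f="\<lambda>\<omega>. C * ?Z n \<omega>"])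
        (use Z dev C in \<open>auto simp: abs_mult\<close>)
    then have "integrable M (\<lambda>\<omega>. g (real n / T n \<omega>) - g l + g l)"
      by (intro Bochner_Integration.integrable_add) simp_all
    then have "integrable M (\<lambda>\<omega>. g (real n / T n \<omega>))"
      by simp
    then have "\<bar>(\<integral>\<omega>. g (real n / T n \<omega>) \<partial>M) - g l\<bar> = \<bar>\<integral>\<omega>. g (real n / T n \<omega>) - g l \<partial>M\<bar>"
      by (simp add: prob_space)
    also have "\<dots> \<le> (\<integral>\<omega>. \<bar>g (real n / T n \<omega>) - g l\<bar> \<partial>M)"
      by (rule integral_abs_bound)
    also have "\<dots> \<le> (\<integral>\<omega>. C * ?Z n \<omega> \<partial>M)"
      using dev int Z by (intro integral_mono_AE) auto
    also have "\<dots> \<le> C * sqrt (?v n)"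
      using EZ C by (simp add: mult_left_mono)
    finally show ?thesis .
  qed
  have "(\<lambda>n. (\<integral>\<omega>. g (real n / T n \<omega>) \<partial>M) - g l) \<longlonglongrightarrow> 0"
    by (rule Lim_null_comparison[OF _ sqrt_v], rule eventually_sequentiallyI[of 3]) (use bound in simp)
  then show ?thesis
    by (simp add: LIM_zero_iff)
qed

section \<open>Lipschitz bounds for the plug-in functions, by the mean value inequality\<close>

lemma abs_exp_minus_diff_le:
  fixes c s t :: real
  assumes "0 \<le> c" "0 \<le> s" "0 \<le> t"
  shows "\<bar>exp (- (c * t)) - exp (- (c * s))\<bar> \<le> c * \<bar>t - s\<bar>"
proof -
  have "norm (exp (- (c * t)) - exp (- (c * s))) \<le> c * norm (t - s)"
  proof (rule field_differentiable_bound[of "{0..}" _ "\<lambda>z. - c * exp (- (c * z))"])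
    fix z :: real assume "z \<in> {0..}"
    then show "norm (- c * exp (- (c * z))) \<le> c"
      using assms(1) mult_left_mono[of "exp (- (c * z))" 1 c] by (simp add: abs_mult)
  qed (use assms in \<open>auto intro!: derivative_eq_intros\<close>)
  then show ?thesis by simp
qed

text \<open>The derivative is \<open>(1 - c * z) * exp (- (c * z))\<close>, and
  \<open>|1 - c * z| \<le> 1 + c * z \<le> exp (c * z)\<close>. The constant 1 also covers
  \<open>c = 0\<close>, where the function is the identity.\<close>

lemma abs_times_exp_minus_diff_le:
  fixes c s t :: real
  assumes "0 \<le> c" "0 \<le> s" "0 \<le> t"
  shows "\<bar>t * exp (- (c * t)) - s * exp (- (c * s))\<bar> \<le> \<bar>t - s\<bar>"
proof -
  have "norm (t * exp (- (c * t)) - s * exp (- (c * s))) \<le> 1 * norm (t - s)"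
  proof (rule field_differentiable_bound[of "{0..}" _ "\<lambda>z. (1 - c * z) * exp (- (c * z))"])
    fix z :: real assume "z \<in> {0..}"
    then have "\<bar>1 - c * z\<bar> \<le> 1 + c * z"
      using assms(1) by (simp add: abs_le_iff)
    also have "\<dots> \<le> exp (c * z)"
      by (rule exp_ge_add_one_self)
    finally show "norm ((1 - c * z) * exp (- (c * z))) \<le> 1"
      by (simp add: abs_mult exp_minus field_simps)
  qed (use assms in \<open>auto intro!: derivative_eq_intros simp: algebra_simps\<close>)
  then show ?thesis by simp
qed

text \<open>Rules out ties: singletons are null for a law with a density, and Fubini for the product
  law then makes the diagonal null.\<close>

lemma (in prob_space) indep_var_AE_neq:
  fixes X Y :: "'a \<Rightarrow> real"
  assumes "indep_var borel X borel Y" and Y: "distributed M lborel Y f"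
  shows "AE \<omega> in M. X \<omega> \<noteq> Y \<omega>"
proof -
  have [measurable]: "X \<in> borel_measurable M" "Y \<in> borel_measurable M"
    and distr: "distr M borel X \<Otimes>\<^sub>M distr M borel Y = distr M (borel \<Otimes>\<^sub>M borel) (\<lambda>\<omega>. (X \<omega>, Y \<omega>))"
    using assms(1) unfolding indep_var_distribution_eq by blast+
  interpret X: prob_space "distr M borel X"
    by (rule prob_space_distr) simp
  interpret Y: prob_space "distr M borel Y"
    by (rule prob_space_distr) simp
  interpret XY: pair_sigma_finite "distr M borel X" "distr M borel Y"
    by unfold_locales
  have "distr M borel Y = distr M lborel Y"
    by (rule distr_cong) simp_all
  then have distr_Y: "distr M borel Y = density lborel f"
    using distributed_distr_eq_density[OF Y] by simp
  have "AE y in distr M borel Y. x \<noteq> y" for x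
    unfolding distr_Y using AE_lborel_singleton[of x] distributed_borel_measurable[OF Y]
    by (subst AE_density) auto
  moreover have "{z \<in> space (distr M borel X \<Otimes>\<^sub>M distr M borel Y). fst z \<noteq> snd z}
      \<in> sets (distr M borel X \<Otimes>\<^sub>M distr M borel Y)"
    by measurable
  ultimately have "AE z in distr M borel X \<Otimes>\<^sub>M distr M borel Y. fst z \<noteq> snd z"
    by (intro XY.AE_pair_measure) auto
  then have "AE \<omega> in M. fst (X \<omega>, Y \<omega>) \<noteq> snd (X \<omega>, Y \<omega>)"
    unfolding distr by (rule AE_distrD[rotated]) simp
  then show ?thesis by simp
qed

section \<open>Reduction of the family to exponential variables\<close>

context exp_family_first_type
begin

lemma A_nonneg:
  assumes "x \<in> supp a b"
  shows "0 \<le> A x"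
  using monotone_onD[OF A_mono, of a x] assms a_less_b A_left by (simp add: supp_def)

lemma supp_atLeastAtMost_subset:
  assumes "z \<in> supp a b"
  shows "{a..z} \<subseteq> supp a b"
  using assms unfolding supp_def by (auto intro: le_less_trans[of _ "ereal z"])

text \<open>Intermediate value theorem between \<open>a\<close>, where \<open>A\<close> is 0, and a
  point near \<open>b\<close>, where \<open>A\<close> exceeds \<open>y\<close>.\<close>

lemma A_surj:
  assumes "0 \<le> y"
  obtains u where "u \<in> supp a b" "A u = y"
proof -
  have "eventually (\<lambda>e. y \<le> A (real_of_ereal e)) (at_left b)"
    using A_right unfolding filterlim_at_top by blast
  then obtain c where c: "c < b" "\<And>e. c < e \<Longrightarrow> e < b \<Longrightarrow> y \<le> A (real_of_ereal e)"
    unfolding eventually_at_left[OF a_less_b] by blast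
  \<comment> \<open>Lying strictly between \<open>ereal a\<close> and \<open>b\<close>, the point
    \<open>e\<close> is finite and belongs to the support.\<close>
  obtain e where e: "max c (ereal a) < e" "e < b"
    using dense[of "max c (ereal a)" b] c(1) a_less_b by auto
  then obtain z where z: "e = ereal z"
    by (cases e) auto
  have "z \<in> supp a b" "y \<le> A z" "a \<le> z"
    using e c(2)[of e] by (auto simp: z supp_def)
  moreover have "continuous_on (supp a b) A"
    using A_deriv by (rule DERIV_continuous_on)
  ultimately obtain u where "a \<le> u" "u \<le> z" "A u = y"
    using IVT'[of A a y z] assms A_left continuous_on_subset supp_atLeastAtMost_subset by metis
  then show thesis
    using that supp_atLeastAtMost_subset[OF \<open>z \<in> supp a b\<close>] by auto
qed

text \<open>As \<open>A\<close> may be flat on intervals, the event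
  \<open>A (Y \<omega>) \<le> y\<close> need not be of the form \<open>Y \<omega> \<le> u\<close>;
  its probability is squeezed between values of the distribution function at preimages of
  \<open>y\<close> and of levels slightly above \<open>y\<close>.\<close>

lemma
  assumes "prob_space M" and [measurable]: "Y \<in> borel_measurable M"
    and distr: "cdf (distr M borel Y) = family_cdf a b A B \<theta>" and theta: "\<theta> \<in> \<Theta>"
  shows AE_in_supp: "AE \<omega> in M. Y \<omega> \<in> supp a b"
    and A_exponential_distributed: "distributed M lborel (\<lambda>\<omega>. A (Y \<omega>)) (exponential_density (B \<theta>))"
proof -
  interpret prob_space M by fact
  note [measurable] = A_measurable
  have pos: "0 < B \<theta>"
    using theta by (rule B_pos)
  have prob_le: "prob {\<omega> \<in> space M. Y \<omega> \<le> u} = 1 - exp (- (B \<theta> * A u))" if "u \<in> supp a b" for u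
  proof -
    have "prob {\<omega> \<in> space M. Y \<omega> \<le> u} = cdf (distr M borel Y) u"
      by (simp add: cdf_def measure_distr vimage_def Int_def conj_commute)
    then show ?thesis
      using that by (simp add: distr family_cdf_def supp_def)
  qed
  have a_supp: "a \<in> supp a b"
    using a_less_b by (simp add: supp_def)
  have "prob {\<omega> \<in> space M. Y \<omega> \<le> a} = 0"
    using prob_le[OF a_supp] A_left by simp
  then have ge_a: "AE \<omega> in M. a < Y \<omega>"
    by (subst AE_iff_measurable[where N="{\<omega> \<in> space M. Y \<omega> \<le> a}"]) (auto simp: emeasure_eq_measure)
  \<comment> \<open>Preimages \<open>u\<close> of ever larger \<open>y\<close> lie below
    \<open>b\<close> and carry mass tending to 1.\<close>
  have "1 - exp (- (B \<theta> * y)) \<le> prob {\<omega> \<in> space M. ereal (Y \<omega>) < b}" if y: "0 \<le> y" for y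
  proof -
    obtain u where u: "u \<in> supp a b" "A u = y"
      using A_surj[OF y] by blast
    have "prob {\<omega> \<in> space M. Y \<omega> \<le> u} \<le> prob {\<omega> \<in> space M. ereal (Y \<omega>) < b}"
      using u(1) by (intro finite_measure_mono) (auto simp: supp_def intro: le_less_trans[of _ "ereal u"])
    then show ?thesis
      using prob_le[OF u(1)] u(2) by simp
  qed
  then have "eventually (\<lambda>y. 1 - exp (- (B \<theta> * y)) \<le> prob {\<omega> \<in> space M. ereal (Y \<omega>) < b}) at_top"
    by (rule eventually_mono[OF eventually_ge_at_top[of 0]])
  moreover have "((\<lambda>y. 1 - exp (- (B \<theta> * y))) \<longlongrightarrow> 1) at_top"
    using pos by real_asymp
  ultimately have "1 \<le> prob {\<omega> \<in> space M. ereal (Y \<omega>) < b}"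
    by (intro tendsto_upperbound) auto
  then have "prob {\<omega> \<in> space M. ereal (Y \<omega>) < b} = 1"
    using measure_ge_1_iff by blast
  then have "AE \<omega> in M. ereal (Y \<omega>) < b"
    by (subst (asm) prob_Collect_eq_1) simp_all
  with ge_a show supp: "AE \<omega> in M. Y \<omega> \<in> supp a b"
    by eventually_elim (simp add: supp_def)

  have "prob {\<omega> \<in> space M. A (Y \<omega>) \<le> y} = 1 - exp (- y * B \<theta>)" if "0 \<le> y" for y
  proof (rule antisym)
    \<comment> \<open>The level \<open>y'\<close> is strictly larger than \<open>y\<close> so that
      \<open>A (Y \<omega>) \<le> y\<close> forces \<open>Y \<omega> \<le> u\<close>; continuity of
      the exponential then allows \<open>y'\<close> to decrease to \<open>y\<close>.\<close>
    have "prob {\<omega> \<in> space M. A (Y \<omega>) \<le> y} \<le> 1 - exp (- (B \<theta> * y'))" if less: "y < y'" for y'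
    proof -
      obtain u where u: "u \<in> supp a b" "A u = y'"
        using A_surj[of y'] less \<open>0 \<le> y\<close> by (metis less_imp_le order_trans)
      have "AE \<omega> in M. A (Y \<omega>) \<le> y \<longrightarrow> Y \<omega> \<le> u"
        using supp
      proof eventually_elim
        case (elim \<omega>)
        then show ?case
          using monotone_onD[OF A_mono u(1) elim] u(2) less by (meson leD le_less_trans linear)
      qed
      then have "prob {\<omega> \<in> space M. A (Y \<omega>) \<le> y} \<le> prob {\<omega> \<in> space M. Y \<omega> \<le> u}"
        by (intro finite_measure_mono_AE) auto
      then show ?thesis
        using prob_le[OF u(1)] u(2) by simp
    qed
    then have "eventually (\<lambda>y'. prob {\<omega> \<in> space M. A (Y \<omega>) \<le> y} \<le> 1 - exp (- (B \<theta> * y'))) (at_right y)"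
      unfolding eventually_at_right_field by (auto intro: exI[of _ "y + 1"])
    moreover have "((\<lambda>y'. 1 - exp (- (B \<theta> * y'))) \<longlongrightarrow> 1 - exp (- (B \<theta> * y))) (at_right y)"
      by (intro tendsto_intros)
    ultimately show "prob {\<omega> \<in> space M. A (Y \<omega>) \<le> y} \<le> 1 - exp (- y * B \<theta>)"
      by (intro tendsto_lowerbound) (auto simp: mult.commute)
    obtain u where u: "u \<in> supp a b" "A u = y"
      using A_surj[OF \<open>0 \<le> y\<close>] by blast
    have "AE \<omega> in M. Y \<omega> \<le> u \<longrightarrow> A (Y \<omega>) \<le> y"
      using supp by eventually_elim (use monotone_onD[OF A_mono _ u(1)] u(2) in auto)
    then have "prob {\<omega> \<in> space M. Y \<omega> \<le> u} \<le> prob {\<omega> \<in> space M. A (Y \<omega>) \<le> y}"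
      by (intro finite_measure_mono_AE) auto
    then show "1 - exp (- y * B \<theta>) \<le> prob {\<omega> \<in> space M. A (Y \<omega>) \<le> y}"
      using prob_le[OF u(1)] u(2) by (simp add: mult.commute)
  qed
  then show "distributed M lborel (\<lambda>\<omega>. A (Y \<omega>)) (exponential_density (B \<theta>))"
    by (subst exponential_distributed_iff[OF pos]) simp
qed

end

section \<open>Limits of the plug-in estimators\<close>

text \<open>For use with \<open>c = A x\<close> and \<open>d = A' x\<close>: the functions of
  \<open>t = n/T\<close> are \<open>d * t * exp (- (c * t))\<close> and
  \<open>1 - exp (- (c * t))\<close>, with Lipschitz constants \<open>|d|\<close> and
  \<open>c\<close>.\<close>

lemma (in prob_space)
  assumes "0 < l" "0 \<le> c" and T: "\<And>n. 1 \<le> n \<Longrightarrow> distributed M lborel (T n) (erlang_density (n - 1) l)"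
  shows expectation_plugin_pdf_tendsto:
      "(\<lambda>n. \<integral>\<omega>. real n * d / T n \<omega> * exp (- (real n * c / T n \<omega>)) \<partial>M) \<longlonglongrightarrow> d * l * exp (- (c * l))"
    and expectation_plugin_cdf_tendsto:
      "(\<lambda>n. \<integral>\<omega>. 1 - exp (- (real n * c / T n \<omega>)) \<partial>M) \<longlonglongrightarrow> 1 - exp (- (l * c))"
proof -
  have "\<bar>d * (t * exp (- (c * t))) - d * (l * exp (- (c * l)))\<bar> \<le> \<bar>d\<bar> * \<bar>t - l\<bar>" if "0 \<le> t" for t
    using abs_times_exp_minus_diff_le[of c l t] assms(1,2) that
    by (simp add: abs_mult mult_left_mono flip: right_diff_distrib)
  from expectation_lipschitz_erlang_inverse_tendsto[OF assms(1) T _ this]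
  show "(\<lambda>n. \<integral>\<omega>. real n * d / T n \<omega> * exp (- (real n * c / T n \<omega>)) \<partial>M) \<longlonglongrightarrow> d * l * exp (- (c * l))"
    by (simp add: ac_simps)
  have "\<bar>(1 - exp (- (c * t))) - (1 - exp (- (c * l)))\<bar> \<le> c * \<bar>t - l\<bar>" if "0 \<le> t" for t
    using abs_exp_minus_diff_le[of c l t] assms(1,2) that by (simp add: abs_minus_commute)
  from expectation_lipschitz_erlang_inverse_tendsto[OF assms(1) T _ this]
  show "(\<lambda>n. \<integral>\<omega>. 1 - exp (- (real n * c / T n \<omega>)) \<partial>M) \<longlonglongrightarrow> 1 - exp (- (l * c))"
    by (simp add: ac_simps)
qed

text \<open>Independence identifies the joint law of the \<open>Y i\<close> with the product
  measure, where the record and the sum of \<open>m\<close> terms have equal laws; that sum is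
  Erlang of shape \<open>m\<close>.\<close>

lemma (in prob_space) upper_record_erlang_distributed:
  assumes "0 < l" and indep: "indep_vars (\<lambda>_. borel) Y UNIV"
    and Y: "\<And>i. distributed M lborel (Y i) (exponential_density l)" and "1 \<le> m"
  shows "distributed M lborel (\<lambda>\<omega>. upper_record (\<lambda>i. Y i \<omega>) m) (erlang_density (m - 1) l)"
proof -
  obtain k where m: "m = Suc k"
    using \<open>1 \<le> m\<close> by (cases m) auto
  have [measurable]: "Y i \<in> borel_measurable M" for i
    using distributed_measurable[OF Y[of i]] by simp
  have to_lborel: "distr N borel g = distr N lborel g" for N and g :: "'z \<Rightarrow> real"
    by (rule distr_cong) simp_all
  have "distr M (\<Pi>\<^sub>M i\<in>UNIV. borel) (\<lambda>\<omega> i. Y i \<omega>) = (\<Pi>\<^sub>M i\<in>UNIV. distr M borel (Y i))"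
    using indep indep_vars_iff_distr_eq_PiM[where I=UNIV and X=Y and M'="\<lambda>_. borel"] by (simp add: restrict_def)
  also have "\<dots> = exponential_sequence l"
    by (simp add: to_lborel distributed_distr_eq_density[OF Y])
  finally have law: "distr M (\<Pi>\<^sub>M i\<in>UNIV. borel) (\<lambda>\<omega> i. Y i \<omega>) = exponential_sequence l" .
  have push: "distr M borel (\<lambda>\<omega>. g (\<lambda>i. Y i \<omega>)) = distr (exponential_sequence l) borel g"
    if "g \<in> borel_measurable (\<Pi>\<^sub>M i\<in>UNIV. borel)" for g :: "(nat \<Rightarrow> real) \<Rightarrow> real"
    unfolding law[symmetric] using that by (subst distr_distr) (simp_all add: comp_def measurable_abs_UNIV)
  have "distr M borel (\<lambda>\<omega>. upper_record (\<lambda>i. Y i \<omega>) m) = distr M borel (\<lambda>\<omega>. \<Sum>i<m. Y i \<omega>)"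
    using push[of "\<lambda>xs. upper_record xs m"] push[of "\<lambda>xs. \<Sum>i<m. xs i"]
      distr_upper_record_exponential[OF assms(1), of k] by (simp add: m)
  moreover have "distributed M lborel (\<lambda>\<omega>. \<Sum>i<m. Y i \<omega>) (erlang_density (card {..<m} - 1) l)"
    using assms by (intro exponential_distributed_sum indep_vars_subset[OF indep]) (auto simp: lessThan_empty_iff)
  moreover have "(\<lambda>\<omega>. upper_record (\<lambda>i. Y i \<omega>) m) \<in> borel_measurable M"
    by (intro measurable_compose[OF _ measurable_upper_record] measurable_abs_UNIV) simp
  ultimately show ?thesis
    by (simp add: distributed_def to_lborel)
qed

theorem theorem5:
  fixes a :: real and b :: ereal and A A' :: "real \<Rightarrow> real"
    and \<Theta> :: "real set" and B :: "real \<Rightarrow> real" and \<theta> :: real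
    and M :: "'w measure" and X :: "nat \<Rightarrow> 'w \<Rightarrow> real" and x :: real
  assumes family: "exp_family_first_type a b A A' \<Theta> B"
    and theta: "\<theta> \<in> \<Theta>"
    and prob: "prob_space M"
    and indep: "prob_space.indep_vars M (\<lambda>_. borel) X UNIV"
    and distributed: "\<And>i. cdf (distr M borel (X i)) = family_cdf a b A B \<theta>"
  shows "((\<lambda>n. \<integral>\<omega>. mle_pdf_sample a b A A' n (\<lambda>i. X i \<omega>) x \<partial>M)
            \<longlonglongrightarrow> family_pdf a b A A' B \<theta> x) \<and>
         ((\<lambda>m. \<integral>\<omega>. mle_pdf_record a b A A' m (\<lambda>i. X i \<omega>) x \<partial>M)
            \<longlonglongrightarrow> family_pdf a b A A' B \<theta> x) \<and>
         ((\<lambda>n. \<integral>\<omega>. mle_cdf_sample a b A n (\<lambda>i. X i \<omega>) x \<partial>M)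
            \<longlonglongrightarrow> family_cdf a b A B \<theta> x) \<and>
         ((\<lambda>m. \<integral>\<omega>. mle_cdf_record a b A m (\<lambda>i. X i \<omega>) x \<partial>M)
            \<longlonglongrightarrow> family_cdf a b A B \<theta> x)"
proof -
  interpret exp_family_first_type a b A A' \<Theta> B
    by (rule family)
  interpret prob_space M
    by (rule prob)
  define Y where "Y = (\<lambda>i \<omega>. A (X i \<omega>))"
  define l where "l = B \<theta>"
  have l: "0 < l"
    unfolding l_def using theta by (rule B_pos)
  note [measurable] = A_measurable
  have X [measurable]: "X i \<in> borel_measurable M" for i
    using indep by (simp add: indep_vars_def)
  have X_supp: "AE \<omega> in M. X i \<omega> \<in> supp a b" for i
    by (rule AE_in_supp[OF prob X distributed theta])
  have Y_exponential: "distributed M lborel (Y i) (exponential_density l)" for i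
    unfolding Y_def l_def by (rule A_exponential_distributed[OF prob X distributed theta])
  have Y_indep: "indep_vars (\<lambda>_. borel) Y UNIV"
    unfolding Y_def by (rule indep_vars_compose2[OF indep]) simp
  have sample: "distributed M lborel (\<lambda>\<omega>. \<Sum>i<n. A (X i \<omega>)) (erlang_density (n - 1) l)" if "1 \<le> n" for n
    using exponential_distributed_sum[of "{..<n}" l Y] that l Y_exponential indep_vars_subset[OF Y_indep, of "{..<n}"]
    by (simp add: lessThan_empty_iff Y_def)
  \<comment> \<open>\<open>A\<close> may be constant on intervals; without ties among the \<open>Y\<^sub>i\<close> it still preserves records.\<close>
  have "AE \<omega> in M. Y i \<omega> \<noteq> Y j \<omega>" if "i \<noteq> j" for i j
  proof (rule indep_var_AE_neq[OF _ Y_exponential])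
    show "indep_var borel (Y i) borel (Y j)"
      using indep_vars_sum[of "{j}" i Y] that indep_vars_subset[OF Y_indep, of "{i, j}"] by simp
  qed
  then have "AE \<omega> in M. i \<noteq> j \<longrightarrow> Y i \<omega> \<noteq> Y j \<omega>" for i j
    by (cases "i = j") simp_all
  then have "AE \<omega> in M. \<forall>i j. i \<noteq> j \<longrightarrow> Y i \<omega> \<noteq> Y j \<omega>"
    by (simp add: AE_all_countable)
  moreover have "AE \<omega> in M. \<forall>i. X i \<omega> \<in> supp a b"
    using X_supp by (simp add: AE_all_countable)
  ultimately have A_record: "AE \<omega> in M. A (upper_record (\<lambda>i. X i \<omega>) m) = upper_record (\<lambda>i. Y i \<omega>) m" for m
  proof eventually_elim
    case (elim \<omega>)
    have "X i \<omega> < X j \<omega> \<longleftrightarrow> Y i \<omega> < Y j \<omega>" for i j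
    proof
      assume less: "X i \<omega> < X j \<omega>"
      then have "Y i \<omega> \<le> Y j \<omega>"
        unfolding Y_def using elim(2) by (intro monotone_onD[OF A_mono]) auto
      moreover have "i \<noteq> j"
        using less by auto
      ultimately show "Y i \<omega> < Y j \<omega>"
        using elim(1) by (simp add: less_le)
    next
      assume "Y i \<omega> < Y j \<omega>"
      then show "X i \<omega> < X j \<omega>"
        using monotone_onD[OF A_mono, of "X j \<omega>" "X i \<omega>"] elim(2) unfolding Y_def by (meson leI not_less)
    qed
    then have "record_index (\<lambda>i. X i \<omega>) k = record_index (\<lambda>i. Y i \<omega>) k" for k
      by (rule record_index_cong)
    then show ?case
      by (simp add: upper_record_def Y_def)
  qed
  have [measurable]: "(\<lambda>\<omega>. upper_record (\<lambda>i. Z i \<omega>) m) \<in> borel_measurable M"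
    if "\<And>i. Z i \<in> borel_measurable M" for Z :: "nat \<Rightarrow> 'w \<Rightarrow> real" and m
    using that by (intro measurable_compose[OF _ measurable_upper_record] measurable_abs_UNIV)
  have [measurable]: "Y i \<in> borel_measurable M" for i
    unfolding Y_def by measurable
  \<comment> \<open>The record estimators depend on the data only through \<open>A\<close> of the
    record, so the almost-sure identity moves their expectations to records of the
    \<open>Y i\<close>.\<close>
  have to_Y: "(\<integral>\<omega>. h (A (upper_record (\<lambda>i. X i \<omega>) m)) \<partial>M) = (\<integral>\<omega>. h (upper_record (\<lambda>i. Y i \<omega>) m) \<partial>M)"
    if [measurable]: "h \<in> borel_measurable borel" for h :: "real \<Rightarrow> real" and m
    using A_record[of m] by (intro integral_cong_AE) (auto elim: eventually_mono)
  note records = upper_record_erlang_distributed[OF l Y_indep Y_exponential]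
  show ?thesis
  proof (cases "x \<in> supp a b")
    case True
    then have c: "0 \<le> A x"
      by (rule A_nonneg)
    have x: "a \<le> x" "ereal x < b"
      using True by (auto simp: supp_def)
    show ?thesis
      using expectation_plugin_pdf_tendsto[OF l c sample, of "A' x"] expectation_plugin_cdf_tendsto[OF l c sample]
        expectation_plugin_pdf_tendsto[OF l c records, of "A' x"] expectation_plugin_cdf_tendsto[OF l c records]
        to_Y[of "\<lambda>t. real n * A' x / t * exp (- (real n * A x / t))" n for n]
        to_Y[of "\<lambda>t. 1 - exp (- (real n * A x / t))" n for n] x True
      by (simp add: mle_pdf_sample_def mle_pdf_record_def mle_cdf_sample_def mle_cdf_record_def
          family_pdf_def family_cdf_def l_def)
  next
    case False
    \<comment> \<open>Off the support each estimator is the constant 0 or 1 that it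
      estimates.\<close>
    then show ?thesis
      by (auto simp: mle_pdf_sample_def mle_pdf_record_def mle_cdf_sample_def mle_cdf_record_def
          family_pdf_def family_cdf_def supp_def prob_space)
  qed
qed

end
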